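(* Let $k \geq 4$ be an integer and let $G$ be a bipartite $P_k$-free graph. Then for every $s\geq 1$ and every $s$-fold product $e_1\cdots e_s$ of edges of $G$ (not necessarily distinct), the graph $G'$ associated to $(I(G)^{s+1} : e_1\cdots e_s)$ is a bipartite $P_k$-free graph.
   Context: Graphs are finite, simple and undirected. For a graph $G$ with vertex set $\{x_1,\ldots,x_n\}$ and a field $K$, the edge ideal is $I(G) = (x_ix_j \mid \{x_i,x_j\}\in E(G)) \subseteq K[x_1,\ldots,x_n]$. An edge $e=\{x_i,x_j\}$ is identified with the monomial $x_ix_j$. For $G$ bipartite, by a theorem of Alilooee and Banerjee, $(I(G)^{s+1}:e_1\cdots e_s)$ is a quadratic squarefree monomial ideal, hence the edge ideal of a graph $G'$ on the vertex set $V(G)$ ("the graph associated to" this ideal). $P_k$ denotes the path on $k$ vertices. A graph is $H$-free if it does not contain an induced subgraph isomorphic to $H$. *)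

theory Defs
  imports "Graph_Theory.Graph_Theory" "HOL-Library.Poly_Mapping"
begin

section \<open>Graphs\<close>

text \<open>
  A finite simple undirected graph is a \<^locale>\<open>pair_graph\<close>: a finite set of vertices with a
  symmetric irreflexive set of arcs. The undirected edge between \<open>u\<close> and \<open>v\<close> is thus represented
  by the two arcs \<open>(u, v)\<close> and \<open>(v, u)\<close>.
\<close>

definition bipartite :: "'v pair_pre_digraph \<Rightarrow> bool" where
  "bipartite G \<longleftrightarrow> (\<exists>A B. pverts G = A \<union> B \<and> A \<inter> B = {} \<and> parcs G \<subseteq> A \<times> B \<union> B \<times> A)"

definition path_graph :: "nat \<Rightarrow> nat pair_pre_digraph" where
  "path_graph k = \<lparr> pverts = {1..k},
     parcs = {(i, j). i \<in> {1..k} \<and> j \<in> {1..k} \<and> (j = i + 1 \<or> i = j + 1)} \<rparr>"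

definition induced_free :: "'w pair_pre_digraph \<Rightarrow> 'v pair_pre_digraph \<Rightarrow> bool" where
  "induced_free H G \<longleftrightarrow>
     \<not> (\<exists>S :: 'v pair_pre_digraph. induced_subgraph (with_proj S) (with_proj G) \<and>
          digraph_iso (with_proj S) (with_proj H))"


section \<open>Ideals in a commutative ring\<close>

text \<open>An ideal is a submodule of the ring regarded as a module over itself.\<close>

lemma module_times: "module ((*) :: 'a :: comm_ring_1 \<Rightarrow> 'a \<Rightarrow> 'a)"
  by unfold_locales (simp_all add: algebra_simps)

definition ideal_gen :: "'a :: comm_ring_1 set \<Rightarrow> 'a set" where
  "ideal_gen B = module.span (*) B"

definition ideal_mult :: "'a :: comm_ring_1 set \<Rightarrow> 'a set \<Rightarrow> 'a set" where
  "ideal_mult I J = ideal_gen {a * b | a b. a \<in> I \<and> b \<in> J}"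

primrec ideal_power :: "'a :: comm_ring_1 set \<Rightarrow> nat \<Rightarrow> 'a set" where
  "ideal_power I 0 = UNIV"
| "ideal_power I (Suc n) = ideal_mult I (ideal_power I n)"

definition ideal_colon :: "'a :: comm_ring_1 set \<Rightarrow> 'a \<Rightarrow> 'a set" where
  "ideal_colon I f = {g. g * f \<in> I}"


section \<open>Edge ideals\<close>

text \<open>
  Polynomials over \<open>'k\<close> in the variables \<open>x\<^sub>v\<close>, where \<open>v\<close> ranges over the whole type \<open>'v\<close>, are
  finitely supported functions from exponent vectors to coefficients. For a graph on a finite
  type \<open>'v\<close> with vertex set \<^term>\<open>UNIV\<close> this is exactly the polynomial ring over \<open>'k\<close> whose
  variables are the vertices.
\<close>

type_synonym ('v, 'k) polynomial = "('v \<Rightarrow>\<^sub>0 nat) \<Rightarrow>\<^sub>0 'k"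

definition var :: "'v \<Rightarrow> ('v, 'k :: field) polynomial" where
  "var v = Poly_Mapping.single (Poly_Mapping.single v 1) 1"

definition edge_monomial :: "'v \<times> 'v \<Rightarrow> ('v, 'k :: field) polynomial" where
  "edge_monomial e = var (fst e) * var (snd e)"

definition edge_ideal :: "'v pair_pre_digraph \<Rightarrow> ('v, 'k :: field) polynomial set" where
  "edge_ideal G = ideal_gen (edge_monomial ` parcs G)"

definition is_graph_of_ideal :: "('v, 'k :: field) polynomial set \<Rightarrow> 'v pair_pre_digraph \<Rightarrow> bool" where
  "is_graph_of_ideal J G \<longleftrightarrow> pair_graph G \<and> pverts G = UNIV \<and> edge_ideal G = J"

end

theory Submission
  imports Defs
begin

text \<open>
  Orient every edge of \<open>G\<close> from one colour class to the other and call the resulting relation \<open>R\<close>.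
  The graph of the colon ideal consists of the pairs \<open>(u, v)\<close> that are evenly connected: there is
  a walk \<open>u = a\<^sub>0, b\<^sub>1, a\<^sub>1, \<dots>, b\<^sub>l, a\<^sub>l, v\<close> whose steps \<open>a\<^sub>i b\<^sub>i\<^sub>+\<^sub>1\<close> and \<open>a\<^sub>l v\<close> are edges of \<open>G\<close> and
  whose steps \<open>b\<^sub>i a\<^sub>i\<close> are among \<open>e\<^sub>1, \<dots>, e\<^sub>s\<close>. All ideals involved are monomial ideals, so this is
  a statement about exponent vectors. On the one hand, exchanging the two kinds of steps along such
  a walk writes \<open>uv e\<^sub>1 \<cdots> e\<^sub>s\<close> as a product of \<open>s + 1\<close> edges; a walk that visits no vertex of the first
  class twice uses every \<open>e\<^sub>i\<close> at most once, so multiplicities are harmless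
  (\<open>even_connected_in_edge_products\<close>). On the other hand, if a monomial \<open>t\<close> is divisible by no
  evenly connected pair, then the vertices of the first class that are not reachable from the support
  of \<open>t\<close> form, together with the neighbours of the reachable ones, a vertex cover that avoids the
  support of \<open>t\<close> and meets each \<open>e\<^sub>i\<close> exactly once. Every product of \<open>s + 1\<close> edges has degree at least \<open>s + 1\<close> on the cover, but \<open>t e\<^sub>1 \<cdots> e\<^sub>s\<close> has
  degree \<open>s\<close> there (\<open>even_connected_if_edge_product_divides\<close>).

  Reachability does not see multiplicities, so adding one more edge \<open>xy\<close> to the list \<open>e\<^sub>1, \<dots>, e\<^sub>s\<close>
  joins every neighbour of \<open>x\<close> to every neighbour of \<open>y\<close> in the current graph and does nothing else
  (\<open>even_connected_Cons\<close>). It remains to see that this one step creates no induced path \<open>P\<^sub>k\<close>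
  (\<open>induced_path_add_biclique\<close>). An induced path meets the complete bipartite graph between the two
  neighbourhoods in at most two edges. If it uses one new edge and meets the neighbourhoods only in
  its ends, the detour through \<open>x\<close> and \<open>y\<close> gives an induced path on \<open>k + 2\<close> vertices of the old
  graph. If it meets one neighbourhood twice and the other once, the middle vertex can be replaced by
  \<open>x\<close> or \<open>y\<close>. In both cases the old graph contains an induced \<open>P\<^sub>k\<close>.
\<close>

section \<open>Monomial ideals\<close>

definition monomial_ideal :: "('v \<Rightarrow>\<^sub>0 nat) set \<Rightarrow> ('v, 'k :: field) polynomial set" where
  "monomial_ideal S = {p. \<forall>t\<in>Poly_Mapping.keys p. \<exists>s\<in>S. \<exists>r. t = s + r}"

lemma single_in_monomial_ideal_iff:
  "Poly_Mapping.single t (1 :: 'k :: field) \<in> monomial_ideal S \<longleftrightarrow> (\<exists>s\<in>S. \<exists>r. t = s + r)"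
  by (simp add: monomial_ideal_def)

lemma single_in_monomial_ideal:
  "s \<in> S \<Longrightarrow> Poly_Mapping.single s (1 :: 'k :: field) \<in> monomial_ideal S"
  unfolding single_in_monomial_ideal_iff by (metis add.right_neutral)

text \<open>
  A monomial ideal depends only on the set of multiples of its generators. Two descriptions of the
  exponents in an ideal can therefore be compared without choosing minimal generators.
\<close>

lemma monomial_ideal_multiples: "monomial_ideal {t. \<exists>s\<in>S. \<exists>r. t = s + r} = monomial_ideal S"
proof -
  have "(\<exists>t. (\<exists>s\<in>S. \<exists>r. t = s + r) \<and> (\<exists>r. u = t + r)) \<longleftrightarrow> (\<exists>s\<in>S. \<exists>r. u = s + r)" for u
  proof
    assume "\<exists>t. (\<exists>s\<in>S. \<exists>r. t = s + r) \<and> (\<exists>r. u = t + r)"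
    then obtain s r r' where "s \<in> S" "u = s + r + r'" by blast
    then have "u = s + (r + r')" by (simp add: add.assoc)
    then show "\<exists>s\<in>S. \<exists>r. u = s + r" using \<open>s \<in> S\<close> by blast
  qed (metis add.right_neutral)
  then show ?thesis unfolding monomial_ideal_def by simp
qed

lemma poly_mapping_sum_singles:
  "(\<Sum>t\<in>Poly_Mapping.keys p. Poly_Mapping.single t (Poly_Mapping.lookup p t)) = p"
proof (rule poly_mapping_eqI)
  fix u
  have "Poly_Mapping.lookup (\<Sum>t\<in>Poly_Mapping.keys p.
          Poly_Mapping.single t (Poly_Mapping.lookup p t)) u
      = (\<Sum>t\<in>Poly_Mapping.keys p. if t = u then Poly_Mapping.lookup p t else 0)"
    by (simp add: lookup_sum lookup_single when_def)
  also have "\<dots> = Poly_Mapping.lookup p u"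
    by (simp add: sum.delta in_keys_iff)
  finally show "Poly_Mapping.lookup (\<Sum>t\<in>Poly_Mapping.keys p.
      Poly_Mapping.single t (Poly_Mapping.lookup p t)) u = Poly_Mapping.lookup p u" .
qed

lemma subspace_monomial_ideal: "module.subspace (*) (monomial_ideal S :: ('v, 'k :: field) polynomial set)"
proof (rule module.subspaceI[OF module_times])
  fix p q :: "('v, 'k :: field) polynomial" assume "p \<in> monomial_ideal S" "q \<in> monomial_ideal S"
  then show "p + q \<in> monomial_ideal S"
    using keys_add[of p q] unfolding monomial_ideal_def by blast
next
  fix c p :: "('v, 'k :: field) polynomial" assume p: "p \<in> monomial_ideal S"
  show "c * p \<in> monomial_ideal S"
    unfolding monomial_ideal_def
  proof (intro CollectI ballI)
    fix t assume "t \<in> Poly_Mapping.keys (c * p)"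
    then obtain a b where t: "t = a + b" and b: "b \<in> Poly_Mapping.keys p"
      using keys_mult[of c p] by blast
    obtain s r where "s \<in> S" "b = s + r" using p b by (auto simp: monomial_ideal_def)
    then show "\<exists>s\<in>S. \<exists>r. t = s + r"
      using t by (intro bexI[of _ s] exI[of _ "a + r"]) (simp_all add: ac_simps)
  qed
qed (simp add: monomial_ideal_def)

lemma ideal_gen_monomials:
  "ideal_gen ((\<lambda>s. Poly_Mapping.single s (1 :: 'k :: field)) ` S) = monomial_ideal S"
proof
  show "ideal_gen ((\<lambda>s. Poly_Mapping.single s (1 :: 'k)) ` S) \<subseteq> monomial_ideal S"
    unfolding ideal_gen_def
  proof (rule module.span_minimal[OF module_times _ subspace_monomial_ideal])
    show "(\<lambda>s. Poly_Mapping.single s (1 :: 'k)) ` S \<subseteq> monomial_ideal S"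
      by (auto intro: single_in_monomial_ideal)
  qed
next
  let ?I = "ideal_gen ((\<lambda>s. Poly_Mapping.single s (1 :: 'k)) ` S)"
  show "monomial_ideal S \<subseteq> ?I"
  proof
    fix p :: "('a, 'k) polynomial" assume p: "p \<in> monomial_ideal S"
    have "(\<Sum>t\<in>Poly_Mapping.keys p. Poly_Mapping.single t (Poly_Mapping.lookup p t)) \<in> ?I"
      unfolding ideal_gen_def
    proof (rule module.span_sum[OF module_times])
      fix t assume "t \<in> Poly_Mapping.keys p"
      then obtain s r where s: "s \<in> S" "t = s + r" using p by (auto simp: monomial_ideal_def)
      have "Poly_Mapping.single r (Poly_Mapping.lookup p t) * Poly_Mapping.single s 1
          \<in> module.span (*) ((\<lambda>s. Poly_Mapping.single s (1 :: 'k)) ` S)"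
        using s by (intro module.span_scale[OF module_times] module.span_base[OF module_times]) simp
      then show "Poly_Mapping.single t (Poly_Mapping.lookup p t)
          \<in> module.span (*) ((\<lambda>s. Poly_Mapping.single s (1 :: 'k)) ` S)"
        using s by (simp add: mult_single ac_simps)
    qed
    then show "p \<in> ?I" by (simp add: poly_mapping_sum_singles)
  qed
qed

lemma ideal_mult_monomial_ideal:
  "ideal_mult (monomial_ideal S) (monomial_ideal T :: ('v, 'k :: field) polynomial set)
    = monomial_ideal {s + t | s t. s \<in> S \<and> t \<in> T}" (is "?L = monomial_ideal ?U")
proof
  show "?L \<subseteq> monomial_ideal ?U"
    unfolding ideal_mult_def ideal_gen_def
  proof (rule module.span_minimal[OF module_times _ subspace_monomial_ideal], safe)
    fix p q :: "('v, 'k) polynomial"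
    assume p: "p \<in> monomial_ideal S" and q: "q \<in> monomial_ideal T"
    show "p * q \<in> monomial_ideal ?U"
      unfolding monomial_ideal_def
    proof (intro CollectI ballI)
      fix t assume "t \<in> Poly_Mapping.keys (p * q)"
      then obtain a b where t: "t = a + b"
        and a: "a \<in> Poly_Mapping.keys p" and b: "b \<in> Poly_Mapping.keys q"
        using keys_mult[of p q] by blast
      obtain s r where s: "s \<in> S" "a = s + r" using p a by (auto simp: monomial_ideal_def)
      obtain s' r' where s': "s' \<in> T" "b = s' + r'" using q b by (auto simp: monomial_ideal_def)
      have "t = (s + s') + (r + r')" using t s s' by (simp add: ac_simps)
      then show "\<exists>s\<in>?U. \<exists>r. t = s + r" using s s' by blast
    qed
  qed
next
  have "ideal_gen ((\<lambda>s. Poly_Mapping.single s (1 :: 'k)) ` ?U) \<subseteq> ?L"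
    unfolding ideal_mult_def ideal_gen_def
  proof (rule module.span_mono[OF module_times], safe)
    fix s t assume st: "s \<in> S" "t \<in> T"
    have "Poly_Mapping.single (s + t) (1 :: 'k) = Poly_Mapping.single s 1 * Poly_Mapping.single t 1"
      by (simp add: mult_single)
    moreover have "Poly_Mapping.single s (1 :: 'k) \<in> monomial_ideal S"
      "Poly_Mapping.single t (1 :: 'k) \<in> monomial_ideal T"
      using st by (auto intro: single_in_monomial_ideal)
    ultimately show "\<exists>a b. Poly_Mapping.single (s + t) (1 :: 'k) = a * b
        \<and> a \<in> monomial_ideal S \<and> b \<in> monomial_ideal T"
      by blast
  qed
  then show "monomial_ideal ?U \<subseteq> ?L" by (simp add: ideal_gen_monomials)
qed

lemma keys_mult_single:
  fixes p :: "('v, 'k :: field) polynomial"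
  shows "Poly_Mapping.keys (p * Poly_Mapping.single m 1) = (\<lambda>t. t + m) ` Poly_Mapping.keys p"
proof
  show "Poly_Mapping.keys (p * Poly_Mapping.single m 1) \<subseteq> (\<lambda>t. t + m) ` Poly_Mapping.keys p"
    using keys_mult[of p "Poly_Mapping.single m 1"] by auto
next
  have expand: "p * Poly_Mapping.single m 1
      = (\<Sum>t\<in>Poly_Mapping.keys p. Poly_Mapping.single (t + m) (Poly_Mapping.lookup p t))"
    by (subst (1) poly_mapping_sum_singles[of p, symmetric]) (simp add: sum_distrib_right mult_single)
  have "Poly_Mapping.lookup (p * Poly_Mapping.single m 1) (u + m) = Poly_Mapping.lookup p u" for u
  proof -
    have "Poly_Mapping.lookup (p * Poly_Mapping.single m 1) (u + m)
        = (\<Sum>t\<in>Poly_Mapping.keys p. if t = u then Poly_Mapping.lookup p t else 0)"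
      by (simp add: expand lookup_sum lookup_single when_def)
    then show ?thesis by (simp add: sum.delta in_keys_iff)
  qed
  then show "(\<lambda>t. t + m) ` Poly_Mapping.keys p \<subseteq> Poly_Mapping.keys (p * Poly_Mapping.single m 1)"
    by (auto simp: in_keys_iff)
qed

lemma ideal_colon_monomial_ideal:
  "ideal_colon (monomial_ideal S) (Poly_Mapping.single m (1 :: 'k :: field))
    = monomial_ideal {t. \<exists>s\<in>S. \<exists>r. t + m = s + r}"
proof -
  have upclosed: "(\<exists>t'. (\<exists>s\<in>S. \<exists>r. t' + m = s + r) \<and> (\<exists>r. t = t' + r))
      \<longleftrightarrow> (\<exists>s\<in>S. \<exists>r. t + m = s + r)" for t
  proof
    assume "\<exists>t'. (\<exists>s\<in>S. \<exists>r. t' + m = s + r) \<and> (\<exists>r. t = t' + r)"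
    then obtain t' r s r' where "t' + m = s + r'" "t = t' + r" "s \<in> S" by blast
    then have "t + m = s + (r' + r)" by (metis add.assoc add.commute)
    then show "\<exists>s\<in>S. \<exists>r. t + m = s + r" using \<open>s \<in> S\<close> by blast
  qed (metis add.right_neutral)
  show ?thesis
    unfolding ideal_colon_def monomial_ideal_def by (simp add: keys_mult_single upclosed)
qed


section \<open>Products of edges\<close>

definition edge_exponent :: "'v \<times> 'v \<Rightarrow> ('v \<Rightarrow>\<^sub>0 nat)" where
  "edge_exponent e = Poly_Mapping.single (fst e) 1 + Poly_Mapping.single (snd e) 1"

definition edge_products :: "('v \<times> 'v) set \<Rightarrow> nat \<Rightarrow> ('v \<Rightarrow>\<^sub>0 nat) set" where
  "edge_products R n = {sum_list (map edge_exponent fs) | fs. length fs = n \<and> set fs \<subseteq> R}"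

lemma edge_monomial_eq_single: "edge_monomial e = Poly_Mapping.single (edge_exponent e) 1"
  by (simp add: edge_monomial_def var_def edge_exponent_def mult_single)

lemma prod_list_edge_monomials:
  "prod_list (map edge_monomial es)
    = Poly_Mapping.single (sum_list (map edge_exponent es)) (1 :: 'k :: field)"
  by (induction es) (simp_all add: edge_monomial_eq_single mult_single)

lemma edge_ideal_eq_monomial_ideal: "edge_ideal G = monomial_ideal (edge_exponent ` parcs G)"
  by (simp add: edge_ideal_def edge_monomial_eq_single image_image
      ideal_gen_monomials[symmetric] cong: image_cong)

lemma edge_products_Suc:
  "edge_products R (Suc n) = {s + t | s t. s \<in> edge_exponent ` R \<and> t \<in> edge_products R n}"
proof (intro equalityI subsetI)
  fix x assume "x \<in> edge_products R (Suc n)"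
  then obtain fs where fs: "x = sum_list (map edge_exponent fs)" "length fs = Suc n" "set fs \<subseteq> R"
    by (auto simp: edge_products_def)
  then obtain e es where "fs = e # es" by (cases fs) auto
  with fs show "x \<in> {s + t | s t. s \<in> edge_exponent ` R \<and> t \<in> edge_products R n}"
    by (auto simp: edge_products_def)
next
  fix x assume "x \<in> {s + t | s t. s \<in> edge_exponent ` R \<and> t \<in> edge_products R n}"
  then obtain e es where "x = edge_exponent e + sum_list (map edge_exponent es)"
    "e \<in> R" "length es = n" "set es \<subseteq> R"
    by (auto simp: edge_products_def)
  then show "x \<in> edge_products R (Suc n)"
    unfolding edge_products_def by (intro CollectI exI[of _ "e # es"]) simp
qed

lemma ideal_power_edge_ideal:
  "ideal_power (edge_ideal G :: ('v, 'k :: field) polynomial set) n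
    = monomial_ideal (edge_products (parcs G) n)"
proof (induction n)
  case 0
  show ?case by (auto simp: edge_products_def monomial_ideal_def)
next
  case (Suc n)
  then show ?case
    by (simp add: edge_ideal_eq_monomial_ideal ideal_mult_monomial_ideal edge_products_Suc)
qed

lemma edge_exponent_swap: "edge_exponent (u, v) = edge_exponent (v, u)"
  by (simp add: edge_exponent_def add.commute)

lemma orient_edges:
  assumes "set fs \<subseteq> R \<union> R\<inverse>"
  shows "\<exists>fs'. length fs' = length fs \<and> set fs' \<subseteq> R
    \<and> sum_list (map edge_exponent fs') = sum_list (map edge_exponent fs)"
  using assms
proof (induction fs)
  case (Cons f fs)
  then obtain fs' where fs': "length fs' = length fs" "set fs' \<subseteq> R"
    "sum_list (map edge_exponent fs') = sum_list (map edge_exponent fs)" by auto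
  obtain f' where "f' \<in> R" "edge_exponent f' = edge_exponent f"
    using Cons.prems by (cases f) (auto simp: edge_exponent_swap)
  with fs' show ?case by (intro exI[of _ "f' # fs'"]) simp
qed simp

text \<open>
  A graph stores each edge with both orientations; for products of edges one orientation suffices.
\<close>

lemma edge_products_symcl: "edge_products (R \<union> R\<inverse>) n = edge_products R n"
proof
  show "edge_products (R \<union> R\<inverse>) n \<subseteq> edge_products R n"
  proof
    fix t assume "t \<in> edge_products (R \<union> R\<inverse>) n"
    then obtain fs where "t = sum_list (map edge_exponent fs)" "length fs = n" "set fs \<subseteq> R \<union> R\<inverse>"
      unfolding edge_products_def by blast
    moreover obtain fs' where "length fs' = length fs" "set fs' \<subseteq> R"
      "sum_list (map edge_exponent fs') = sum_list (map edge_exponent fs)"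
      using orient_edges[OF \<open>set fs \<subseteq> R \<union> R\<inverse>\<close>] by blast
    ultimately show "t \<in> edge_products R n"
      unfolding edge_products_def by (metis (mono_tags, lifting) mem_Collect_eq)
  qed
  show "edge_products R n \<subseteq> edge_products (R \<union> R\<inverse>) n"
    unfolding edge_products_def by blast
qed

lemma edge_divides_edgeD:
  assumes "edge_exponent (a, b) = edge_exponent (c, d) + r" and "a \<noteq> b" and "c \<noteq> d"
  shows "(a, b) = (c, d) \<or> (a, b) = (d, c)"
proof -
  have *: "Poly_Mapping.lookup (edge_exponent (a, b)) v
      = Poly_Mapping.lookup (edge_exponent (c, d)) v + Poly_Mapping.lookup r v" for v
    using assms(1) by (simp add: lookup_add)
  show ?thesis
    using *[of c] *[of d] assms(2,3)
    by (auto simp: edge_exponent_def lookup_add lookup_single when_def split: if_splits)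
qed

text \<open>
  A graph can be read off from its edge ideal, because all generators have degree two and therefore
  divide each other only if they are equal. This gives uniqueness of the graph of an ideal.
\<close>

lemma edge_ideal_inj:
  assumes "pair_graph G" "pair_graph H"
    and "(edge_ideal G :: ('v, 'k :: field) polynomial set) \<subseteq> edge_ideal H"
  shows "parcs G \<subseteq> parcs H"
proof
  interpret G: pair_graph G by fact
  interpret H: pair_graph H by fact
  fix e assume e: "e \<in> parcs G"
  have "Poly_Mapping.single (edge_exponent e) (1 :: 'k) \<in> edge_ideal G"
    using e by (auto simp: edge_ideal_eq_monomial_ideal intro: single_in_monomial_ideal)
  then obtain f r where f: "f \<in> parcs H" "edge_exponent e = edge_exponent f + r"
    using assms(3) by (fastforce simp: edge_ideal_eq_monomial_ideal single_in_monomial_ideal_iff)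
  obtain a b c d where ef: "e = (a, b)" "f = (c, d)" by (cases e, cases f)
  have "e = f \<or> e = (d, c)"
    using edge_divides_edgeD[of a b c d r] f e ef G.pair_no_loops[OF e] H.pair_no_loops[OF f(1)] by auto
  then show "e \<in> parcs H" using f ef H.arcs_symmetric by auto
qed


section \<open>Even connections\<close>

text \<open>
  The relation \<open>R\<close> is meant to be directed from one colour class of a bipartite graph to the other.
  One step of the closure goes along an edge of \<open>R\<close> and back along a member of \<open>es\<close>, so that the
  walk stays in the first class between steps. In contrast to the usual notion of even-connection,
  the walk may use a member of \<open>es\<close> more often than it occurs in the list.
\<close>

definition even_connected :: "('v \<times> 'v) set \<Rightarrow> ('v \<times> 'v) list \<Rightarrow> ('v \<times> 'v) set" where
  "even_connected R es = (R O (set es)\<inverse>)\<^sup>* O R"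

lemma even_connected_subset:
  assumes "R \<subseteq> A \<times> B"
  shows "even_connected R es \<subseteq> A \<times> B"
proof (safe)
  fix u v assume "(u, v) \<in> even_connected R es"
  then obtain c where c: "(u, c) \<in> (R O (set es)\<inverse>)\<^sup>*" "(c, v) \<in> R"
    by (auto simp: even_connected_def)
  show "v \<in> B" using c(2) assms by auto
  show "u \<in> A" using c assms by (cases rule: converse_rtranclE) auto
qed

lemma even_connected_Nil: "even_connected R [] = R"
  by (simp add: even_connected_def)

lemma even_connected_base: "R \<subseteq> even_connected R es"
  by (auto simp: even_connected_def)

text \<open>
  A walk that uses the edge \<open>(x, y)\<close> several times can be shortened between the first arrival at \<open>y\<close>
  and the last departure from \<open>x\<close>; so one use is enough.
\<close>

lemma even_connected_Cons:
  "even_connected R ((x, y) # es) = even_connected R es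
    \<union> {(u, v). (u, y) \<in> even_connected R es \<and> (x, v) \<in> even_connected R es}"
proof (intro equalityI subrelI)
  let ?r = "R O (set es)\<inverse>" and ?r' = "R O (set ((x, y) # es))\<inverse>"
  fix u v assume "(u, v) \<in> even_connected R ((x, y) # es)"
  then obtain c where c: "(u, c) \<in> ?r'\<^sup>*" and cv: "(c, v) \<in> R"
    by (auto simp: even_connected_def)
  from c have "(u, c) \<in> ?r\<^sup>* \<or> (u, y) \<in> even_connected R es \<and> (x, c) \<in> ?r\<^sup>*"
  proof (induction rule: rtrancl_induct)
    case (step c d)
    then consider "(c, d) \<in> ?r" | "(c, y) \<in> R" "d = x" by auto
    then show ?case
    proof cases
      case 1
      then show ?thesis using step.IH by (meson rtrancl.rtrancl_into_rtrancl)
    next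
      case 2
      then show ?thesis using step.IH by (auto simp: even_connected_def)
    qed
  qed simp
  then show "(u, v) \<in> even_connected R es
      \<union> {(u, v). (u, y) \<in> even_connected R es \<and> (x, v) \<in> even_connected R es}"
    using cv by (auto simp: even_connected_def)
next
  let ?r = "R O (set es)\<inverse>" and ?r' = "R O (set ((x, y) # es))\<inverse>"
  have mono: "?r\<^sup>* \<subseteq> ?r'\<^sup>*" by (intro rtrancl_mono) auto
  fix u v assume "(u, v) \<in> even_connected R es
      \<union> {(u, v). (u, y) \<in> even_connected R es \<and> (x, v) \<in> even_connected R es}"
  then consider "(u, v) \<in> even_connected R es"
    | "(u, y) \<in> even_connected R es" "(x, v) \<in> even_connected R es" by blast
  then show "(u, v) \<in> even_connected R ((x, y) # es)"
  proof cases
    case 1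
    then show ?thesis using mono by (auto simp: even_connected_def)
  next
    case 2
    then obtain c d where "(u, c) \<in> ?r'\<^sup>*" "(c, y) \<in> R" and d: "(x, d) \<in> ?r'\<^sup>*" "(d, v) \<in> R"
      using mono by (auto simp: even_connected_def)
    moreover have "(c, x) \<in> ?r'" using \<open>(c, y) \<in> R\<close> by auto
    ultimately have "(u, x) \<in> ?r'\<^sup>*" by (rule_tac rtrancl_into_rtrancl)
    with d show ?thesis unfolding even_connected_def by (meson relcompI rtrancl_trans)
  qed
qed

text \<open>
  Cutting off everything before the last visit to \<open>a\<close> leaves a walk that never returns to \<open>a\<close>.
\<close>

lemma rtrancl_avoiding_source:
  "(a, v) \<in> r\<^sup>* \<Longrightarrow> (a, v) \<in> {(c, d) \<in> r. d \<noteq> a}\<^sup>*"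
proof (induction rule: rtrancl_induct)
  case (step c d)
  then show ?case
    by (cases "d = a") (auto intro: rtrancl_into_rtrancl)
qed simp

text \<open>
  If the walk from \<open>u\<close> to \<open>v\<close> starts with \<open>u, b, a\<close>, where \<open>(a, b)\<close> is in the list, then exchanging
  this first pair of steps replaces \<open>(u, v)\<close> by \<open>(a, v)\<close> and removes \<open>(a, b)\<close> from the list. The
  rest of the walk survives the removal because it can be chosen not to return to \<open>a\<close>.
\<close>

lemma even_connected_in_edge_products:
  assumes "set es \<subseteq> R" and "(u, v) \<in> even_connected R es"
  shows "edge_exponent (u, v) + sum_list (map edge_exponent es) \<in> edge_products R (Suc (length es))"
  using assms
proof (induction "length es" arbitrary: es u rule: less_induct)
  case less
  obtain c where c: "(u, c) \<in> (R O (set es)\<inverse>)\<^sup>*" and cv: "(c, v) \<in> R"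
    using less.prems by (auto simp: even_connected_def)
  from c show ?case
  proof (cases rule: converse_rtranclE)
    case base
    then have "set ((u, v) # es) \<subseteq> R" using cv less.prems by simp
    then show ?thesis
      unfolding edge_products_def by (intro CollectI exI[of _ "(u, v) # es"]) simp
  next
    case (step a)
    then obtain b where ub: "(u, b) \<in> R" and ab: "(a, b) \<in> set es" by auto
    let ?es = "remove1 (a, b) es"
    have len: "Suc (length ?es) = length es"
      using ab length_pos_if_in_set[OF ab] by (simp add: length_remove1)
    have "{(c, d) \<in> R O (set es)\<inverse>. d \<noteq> a} \<subseteq> R O (set ?es)\<inverse>"
    proof (intro subrelI)
      fix p q assume "(p, q) \<in> {(c, d) \<in> R O (set es)\<inverse>. d \<noteq> a}"
      then obtain z where "(p, z) \<in> R" "(q, z) \<in> set es" "q \<noteq> a" by auto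
      then have "(q, z) \<in> set ?es" by (simp add: in_set_remove1)
      then show "(p, q) \<in> R O (set ?es)\<inverse>" using \<open>(p, z) \<in> R\<close> by (blast intro: relcompI)
    qed
    then have "(a, c) \<in> (R O (set ?es)\<inverse>)\<^sup>*"
      using rtrancl_avoiding_source[OF step(2)] rtrancl_mono by blast
    then have "(a, v) \<in> even_connected R ?es"
      using cv by (auto simp: even_connected_def)
    moreover have "set ?es \<subseteq> R" using less.prems set_remove1_subset by fast
    ultimately have IH: "edge_exponent (a, v) + sum_list (map edge_exponent ?es)
        \<in> edge_products R (length es)"
      using less.hyps[of ?es a] len by simp
    have "edge_exponent (u, v) + sum_list (map edge_exponent es)
        = edge_exponent (u, b) + (edge_exponent (a, v) + sum_list (map edge_exponent ?es))"
      using sum_list_map_remove1[OF ab, of edge_exponent]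
      by (simp add: edge_exponent_def ac_simps)
    then show ?thesis using IH ub by (auto simp: edge_products_Suc)
  qed
qed

text \<open>
  The counting argument is weak duality in Koenig's theorem: the vertex cover \<open>C\<close> certifies that
  \<open>t\<close> and the list together contain no more than \<open>length es\<close> edges.
\<close>

lemma even_connected_if_edge_product_divides:
  fixes R :: "('v :: finite \<times> 'v) set"
  assumes R: "R \<subseteq> A \<times> B" and AB: "A \<inter> B = {}" and es: "set es \<subseteq> R"
    and fs: "set fs \<subseteq> R" "length fs = Suc (length es)"
    and eq: "t + sum_list (map edge_exponent es) = sum_list (map edge_exponent fs) + r"
  shows "\<exists>e\<in>even_connected R es. \<exists>r. t = edge_exponent e + r"
proof (rule ccontr)
  assume none: "\<not> ?thesis"
  \<comment> \<open>\<open>T\<close> is the set of vertices reachable from the support of \<open>t\<close> in \<open>A\<close>, and \<open>w\<close> is the degree on the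
    cover \<open>C\<close>.\<close>
  define U where "U = {u \<in> A. Poly_Mapping.lookup t u > 0}"
  define T where "T = (R O (set es)\<inverse>)\<^sup>* `` U"
  define C where "C = (A - T) \<union> R `` T"
  define w where "w m = (\<Sum>v\<in>C. Poly_Mapping.lookup m v)" for m :: "'v \<Rightarrow>\<^sub>0 nat"
  have w_add: "w (m + m') = w m + w m'" for m m'
    by (simp add: w_def lookup_add sum.distrib)
  have w_edge: "w (edge_exponent (a, b)) = of_bool (a \<in> C) + of_bool (b \<in> C)" for a b
    by (simp add: w_def edge_exponent_def lookup_add lookup_single when_def sum.distrib sum.delta)
  have cover: "1 \<le> w (edge_exponent e)" if "e \<in> R" for e
    using that R by (cases e) (auto simp: w_edge C_def)
  have exact: "w (edge_exponent e) = 1" if e: "e \<in> set es" for e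
  proof -
    obtain a b where ab: "e = (a, b)" "(a, b) \<in> R" "a \<in> A" "b \<in> B" "a \<notin> B" "b \<notin> A"
      using subsetD[OF es e] R AB by (cases e) auto
    have "a \<in> T" if b: "b \<in> R `` T"
    proof -
      obtain c where "c \<in> T" "(c, b) \<in> R" using b by auto
      then obtain u where "u \<in> U" "(u, c) \<in> (R O (set es)\<inverse>)\<^sup>*" "(c, a) \<in> R O (set es)\<inverse>"
        using e ab by (auto simp: T_def)
      then show ?thesis unfolding T_def by (meson Image_iff rtrancl.rtrancl_into_rtrancl)
    qed
    moreover have "a \<notin> R `` T" using ab R by auto
    ultimately show ?thesis using ab unfolding ab(1) w_edge C_def by auto
  qed
  \<comment> \<open>A vertex of the support of \<open>t\<close> in \<open>R `` T\<close> would be evenly connected to a vertex of \<open>U\<close>.\<close>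
  have "Poly_Mapping.lookup t v = 0" if v: "v \<in> C" for v
  proof (rule ccontr)
    assume nz: "Poly_Mapping.lookup t v \<noteq> 0"
    show False
    proof (cases "v \<in> R `` T")
      case False
      then have "v \<in> U" "v \<notin> T" using v nz by (auto simp: C_def U_def)
      then show False unfolding T_def by auto
    next
      case True
      then obtain c u where u: "u \<in> U" "(u, c) \<in> (R O (set es)\<inverse>)\<^sup>*" "(c, v) \<in> R"
        by (auto simp: T_def)
      then have uv: "(u, v) \<in> even_connected R es" by (auto simp: even_connected_def)
      have "u \<noteq> v" using u R AB by (auto simp: U_def)
      have "t = edge_exponent (u, v) + (t - edge_exponent (u, v))"
        using u(1) nz \<open>u \<noteq> v\<close>
        by (intro poly_mapping_eqI)
          (auto simp: edge_exponent_def lookup_add lookup_minus lookup_single when_def U_def)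
      then show False using none uv by blast
    qed
  qed
  then have "w t = 0" by (simp add: w_def)
  moreover have "w (sum_list (map edge_exponent es)) = length es"
    using exact by (induction es) (simp_all add: w_add, simp add: w_def)
  moreover have "length fs \<le> w (sum_list (map edge_exponent fs))"
    using fs(1) cover by (induction fs) (force simp: w_add)+
  ultimately show False using fs(2) arg_cong[OF eq, of w] by (simp add: w_add)
qed


section \<open>Induced paths\<close>

definition induced_path :: "('v \<times> 'v) set \<Rightarrow> nat \<Rightarrow> (nat \<Rightarrow> 'v) \<Rightarrow> bool" where
  "induced_path R k f \<longleftrightarrow> inj_on f {1..k} \<and>
     (\<forall>i\<in>{1..k}. \<forall>j\<in>{1..k}. (f i, f j) \<in> R \<longleftrightarrow> j = i + 1 \<or> i = j + 1)"

text \<open>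
  An isomorphism between an induced subgraph and \<open>P\<^sub>k\<close> is the same as an enumeration of its vertices
  along the path.
\<close>

lemma induced_free_path_graph_iff:
  assumes "pair_graph G"
  shows "induced_free (path_graph k) G
    \<longleftrightarrow> \<not> (\<exists>f. f ` {1..k} \<subseteq> pverts G \<and> induced_path (parcs G) k f)"
proof -
  interpret pair_graph G by fact
  have "\<exists>f. f ` {1..k} \<subseteq> pverts G \<and> induced_path (parcs G) k f"
    if S: "induced_subgraph (with_proj S) (with_proj G)"
      and iso: "digraph_iso (with_proj S) (with_proj (path_graph k))" for S
  proof -
    obtain h where h: "pre_digraph.digraph_isomorphism (with_proj S) h"
      and eq: "with_proj (path_graph k) = app_iso h (with_proj S)"
      using iso by (auto simp: digraph_iso_def)
    have vs: "iso_verts h ` pverts S = {1..k}" and as: "iso_arcs h ` parcs S = parcs (path_graph k)"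
      and tl: "iso_tail h = fst" and hd: "iso_head h = snd"
      using arg_cong[OF eq, of verts] arg_cong[OF eq, of arcs]
        arg_cong[OF eq, of tail] arg_cong[OF eq, of head]
      by (simp_all add: path_graph_def)
    have inj: "inj_on (iso_verts h) (pverts S)"
      and ends: "\<And>a b. (a, b) \<in> parcs S \<Longrightarrow> iso_arcs h (a, b) = (iso_verts h a, iso_verts h b)"
      using h by (auto simp: pre_digraph.digraph_isomorphism_def tl hd prod_eq_iff)
    have ind: "parcs S = {e \<in> parcs G. fst e \<in> pverts S \<and> snd e \<in> pverts S}"
      and sub: "pverts S \<subseteq> pverts G"
      using S by (auto simp: induced_subgraph_def subgraph_def)
    define f where "f = the_inv_into (pverts S) (iso_verts h)"
    have f: "f i \<in> pverts S" "iso_verts h (f i) = i" if "i \<in> {1..k}" for i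
      using that vs inj
      by (auto simp: f_def the_inv_into_into f_the_inv_into_f)
    have "(f i, f j) \<in> parcs G \<longleftrightarrow> j = i + 1 \<or> i = j + 1" if ij: "i \<in> {1..k}" "j \<in> {1..k}" for i j
    proof
      assume "(f i, f j) \<in> parcs G"
      then have "(f i, f j) \<in> parcs S" using f ij by (auto simp: ind)
      then have "(i, j) \<in> parcs (path_graph k)"
        using ends f ij as by (metis image_eqI)
      then show "j = i + 1 \<or> i = j + 1" by (auto simp: path_graph_def)
    next
      assume "j = i + 1 \<or> i = j + 1"
      then have "(i, j) \<in> iso_arcs h ` parcs S" using ij unfolding as by (auto simp: path_graph_def)
      then obtain a b where ab: "(a, b) \<in> parcs S" "iso_verts h a = i" "iso_verts h b = j"
        using ends by force
      then have "a \<in> pverts S" "b \<in> pverts S" using ind by auto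
      then have "a = f i" "b = f j" using ab inj by (auto simp: f_def the_inv_into_f_f)
      then show "(f i, f j) \<in> parcs G" using ab ind by auto
    qed
    moreover have "inj_on f {1..k}" using f(2) by (metis inj_onI)
    ultimately show ?thesis using f(1) sub unfolding induced_path_def by blast
  qed
  moreover have "\<exists>S. induced_subgraph (with_proj S) (with_proj G)
      \<and> digraph_iso (with_proj S) (with_proj (path_graph k))"
    if f: "f ` {1..k} \<subseteq> pverts G" and ip: "induced_path (parcs G) k f" for f
  proof -
    define S where "S = \<lparr> pverts = f ` {1..k},
      parcs = {e \<in> parcs G. fst e \<in> f ` {1..k} \<and> snd e \<in> f ` {1..k}} \<rparr>"
    define g where "g = the_inv_into {1..k} f"
    define h where "h = \<lparr> iso_verts = g, iso_arcs = map_prod g g, iso_head = snd, iso_tail = fst \<rparr>"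
    have inj: "inj_on f {1..k}" using ip by (simp add: induced_path_def)
    have g: "g (f i) = i" if "i \<in> {1..k}" for i
      using that inj by (simp add: g_def the_inv_into_f_f)
    have wfS: "wf_digraph (with_proj S)" by unfold_locales (auto simp: S_def)
    have "induced_subgraph (with_proj S) (with_proj G)"
      using f wfS wf_digraph_wp_iff pair_wf_digraph
      by (auto simp: induced_subgraph_def subgraph_def compatible_def S_def)
    moreover have injg: "inj_on g (f ` {1..k})"
      using g by (auto intro!: inj_onI)
    have "inj_on (map_prod g g) (f ` {1..k} \<times> f ` {1..k})"
      using injg by (rule map_prod_inj_on) (rule injg)
    then have "inj_on (map_prod g g) (parcs S)"
      by (rule inj_on_subset) (auto simp: S_def)
    then have "pre_digraph.digraph_isomorphism (with_proj S) h"
      using wfS injg by (auto simp: pre_digraph.digraph_isomorphism_def h_def S_def)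
    moreover have "g ` f ` {1..k} = {1..k}" using g by (force simp: image_image)
    moreover have "map_prod g g ` parcs S = parcs (path_graph k)"
    proof (intro equalityI subrelI)
      fix i j assume "(i, j) \<in> map_prod g g ` parcs S"
      then show "(i, j) \<in> parcs (path_graph k)"
        using ip g by (auto simp: S_def path_graph_def induced_path_def)
    next
      fix i j assume ij: "(i, j) \<in> parcs (path_graph k)"
      then have "(f i, f j) \<in> parcs S"
        using ip by (auto simp: S_def path_graph_def induced_path_def)
      moreover have "map_prod g g (f i, f j) = (i, j)" using g ij by (auto simp: path_graph_def)
      ultimately show "(i, j) \<in> map_prod g g ` parcs S" by (metis image_eqI)
    qed
    ultimately have "digraph_iso (with_proj S) (with_proj (path_graph k))"
      unfolding digraph_iso_def
      by (intro exI[of _ h]) (simp add: app_iso_def with_proj_def h_def S_def path_graph_def)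
    then show ?thesis using \<open>induced_subgraph (with_proj S) (with_proj G)\<close> by blast
  qed
  ultimately show ?thesis unfolding induced_free_def by blast
qed

lemma induced_path_shorter: "induced_path R n f \<Longrightarrow> k \<le> n \<Longrightarrow> induced_path R k f"
  unfolding induced_path_def by (auto intro: inj_on_subset)


text \<open>
  For an edge \<open>(x, y)\<close> of a bipartite graph, this is the graph of the colon ideal for the
  single edge \<open>xy\<close>.
\<close>

definition add_biclique :: "('v \<times> 'v) set \<Rightarrow> 'v \<Rightarrow> 'v \<Rightarrow> ('v \<times> 'v) set" where
  "add_biclique R x y = R \<union> R `` {x} \<times> R `` {y} \<union> R `` {y} \<times> R `` {x}"

lemma add_biclique_commute: "add_biclique R x y = add_biclique R y x"
  by (auto simp: add_biclique_def)

text \<open>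
  The case in which the path meets the neighbourhood of \<open>y\<close> at least twice. As \<open>f c\<close> is adjacent to
  all of these vertices, they are exactly its two neighbours on the path; and \<open>c\<close> is the only index
  with two such neighbours, so the new edges on the path all end in \<open>f c\<close>. In the old graph, \<open>y\<close> has
  the same neighbours on the path as \<open>f c\<close> has in the new one, and can take its place.
\<close>

lemma induced_path_replace_centre:
  assumes "sym R" and "irrefl R" and xy: "(x, y) \<in> R"
    and path: "induced_path (add_biclique R x y) k f"
    and c: "c \<in> {1..k}" "f c \<in> R `` {x}"
    and ab: "a \<in> {1..k}" "b \<in> {1..k}" "a \<noteq> b" "f a \<in> R `` {y}" "f b \<in> R `` {y}"
  shows "induced_path R k (f(c := y))"
proof -
  have sR: "(u, v) \<in> R \<longleftrightarrow> (v, u) \<in> R" for u v using \<open>sym R\<close> by (auto dest: symD)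
  have inj: "f i = f j \<Longrightarrow> i = j" if "i \<in> {1..k}" "j \<in> {1..k}" for i j
    using path that by (auto simp: induced_path_def dest: inj_onD)
  have adj: "(f i, f j) \<in> add_biclique R x y \<longleftrightarrow> j = i + 1 \<or> i = j + 1"
    if "i \<in> {1..k}" "j \<in> {1..k}" for i j
    using path that by (auto simp: induced_path_def)
  have XY: "j = i + 1 \<or> i = j + 1"
    if "i \<in> {1..k}" "j \<in> {1..k}" "f i \<in> R `` {x}" "f j \<in> R `` {y}" for i j
    using adj[OF that(1,2)] that(3,4) by (auto simp: add_biclique_def)
  have Y: "(y, f j) \<in> R \<longleftrightarrow> j = c + 1 \<or> c = j + 1" if j: "j \<in> {1..k}" for j
  proof
    assume "(y, f j) \<in> R"
    then show "j = c + 1 \<or> c = j + 1" using XY[OF c(1) j c(2)] by simp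
  next
    assume "j = c + 1 \<or> c = j + 1"
    then have "j = a \<or> j = b"
      using XY[OF c(1) ab(1) c(2) ab(4)] XY[OF c(1) ab(2) c(2) ab(5)] ab(3) by auto
    then show "(y, f j) \<in> R" using ab by auto
  qed
  have X: "i = c" if i: "i \<in> {1..k}" "f i \<in> R `` {x}" for i
    using XY[OF c(1) ab(1) c(2) ab(4)] XY[OF c(1) ab(2) c(2) ab(5)]
      XY[OF i(1) ab(1) i(2) ab(4)] XY[OF i(1) ab(2) i(2) ab(5)] ab(3) by linarith
  have y: "f i \<noteq> y" if "i \<in> {1..k}" "i \<noteq> c" for i
    using X[OF that(1)] that(2) xy by auto
  have old: "(f i, f j) \<in> R \<longleftrightarrow> j = i + 1 \<or> i = j + 1"
    if "i \<in> {1..k}" "j \<in> {1..k}" "i \<noteq> c" "j \<noteq> c" for i j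
    using adj[OF that(1,2)] X[OF that(1)] X[OF that(2)] that(3,4) by (auto simp: add_biclique_def)
  have "inj_on (f(c := y)) {1..k}"
    using inj y by (intro inj_onI) (metis fun_upd_apply)
  moreover have "((f(c := y)) i, (f(c := y)) j) \<in> R \<longleftrightarrow> j = i + 1 \<or> i = j + 1"
    if "i \<in> {1..k}" "j \<in> {1..k}" for i j
    using that old[of i j] Y[of i] Y[of j] sR[of "f i" y] \<open>irrefl R\<close>
    by (auto simp: irrefl_def)
  ultimately show ?thesis by (simp add: induced_path_def)
qed

text \<open>
  The case in which the path meets the two neighbourhoods only in the ends of one new edge. Then
  \<open>x\<close> and \<open>y\<close> do not lie on the path, since otherwise that edge would be an old one, and each of them
  has only one neighbour on it. So \<open>x, y\<close> can be inserted between the two ends.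
\<close>

lemma induced_path_subdivide:
  assumes "sym R" and "irrefl R" and xy: "(x, y) \<in> R"
    and path: "induced_path (add_biclique R x y) k f"
    and c: "c \<in> {1..k}" "c + 1 \<in> {1..k}"
    and X: "\<And>i. i \<in> {1..k} \<Longrightarrow> f i \<in> R `` {x} \<longleftrightarrow> i = c"
    and Y: "\<And>i. i \<in> {1..k} \<Longrightarrow> f i \<in> R `` {y} \<longleftrightarrow> i = c + 1"
    and new: "(f c, f (c + 1)) \<notin> R"
  shows "\<exists>g. induced_path R (k + 2) g"
proof -
  have sR: "(u, v) \<in> R \<longleftrightarrow> (v, u) \<in> R" for u v using \<open>sym R\<close> by (auto dest: symD)
  have inj: "f i = f j \<longleftrightarrow> i = j" if "i \<in> {1..k}" "j \<in> {1..k}" for i j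
    using path that by (auto simp: induced_path_def dest: inj_onD)
  have adj: "(f i, f j) \<in> add_biclique R x y \<longleftrightarrow> j = i + 1 \<or> i = j + 1"
    if "i \<in> {1..k}" "j \<in> {1..k}" for i j
    using path that by (auto simp: induced_path_def)
  have old: "(f i, f j) \<in> R \<longleftrightarrow> (j = i + 1 \<and> i \<noteq> c) \<or> (i = j + 1 \<and> j \<noteq> c)"
    if ij: "i \<in> {1..k}" "j \<in> {1..k}" for i j
    using adj[OF ij] X[OF ij(1)] X[OF ij(2)] Y[OF ij(1)] Y[OF ij(2)] new sR[of "f c" "f (c + 1)"]
    by (auto simp: add_biclique_def)
  have xf: "(x, f i) \<in> R \<longleftrightarrow> i = c" and yf: "(y, f i) \<in> R \<longleftrightarrow> i = c + 1" if "i \<in> {1..k}" for i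
    using X[OF that] Y[OF that] by auto
  have nx: "f i \<noteq> x" and ny: "f i \<noteq> y" if i: "i \<in> {1..k}" for i
  proof -
    show "f i \<noteq> x"
    proof
      assume fi: "f i = x"
      then have "i = c + 1" using yf[OF i] xy sR by auto
      then show False using xf[OF c(1)] fi new sR by auto
    qed
    show "f i \<noteq> y"
    proof
      assume fi: "f i = y"
      then have "i = c" using xf[OF i] xy by auto
      then show False using yf[OF c(2)] fi new by auto
    qed
  qed
  define g where "g i = (if i \<le> c then f i else if i = c + 1 then x
    else if i = c + 2 then y else f (i - 2))" for i
  have pos: "(i \<in> {1..k} \<and> i \<le> c \<and> g i = f i) \<or> (i = c + 1 \<and> g i = x) \<or> (i = c + 2 \<and> g i = y)
      \<or> (\<exists>i'\<in>{1..k}. i = i' + 2 \<and> c < i' \<and> g i = f i')" if i: "i \<in> {1..k + 2}" for i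
  proof -
    have "i - 2 \<in> {1..k} \<and> i = (i - 2) + 2 \<and> c < i - 2" if "i > c + 2"
      using i that by auto
    then show ?thesis using i c unfolding g_def by (cases "i > c + 2") auto
  qed
  have xyR: "x \<noteq> y" "y \<noteq> x" "(x, x) \<notin> R" "(y, y) \<notin> R" "(y, x) \<in> R"
    using xy sR \<open>irrefl R\<close> by (auto simp: irrefl_def)
  have fx: "(f i, x) \<in> R \<longleftrightarrow> i = c" and fy: "(f i, y) \<in> R \<longleftrightarrow> i = c + 1" if "i \<in> {1..k}" for i
    using xf[OF that] yf[OF that] sR by auto
  have nx': "x \<noteq> f i" and ny': "y \<noteq> f i" if "i \<in> {1..k}" for i
    using nx[OF that] ny[OF that] by auto
  note facts = xy xyR inj old xf yf fx fy nx ny nx' ny'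
  have "i = j" if ij: "i \<in> {1..k + 2}" "j \<in> {1..k + 2}" "g i = g j" for i j
    using pos[OF ij(1)] pos[OF ij(2)] ij(3)
    by (elim disjE conjE bexE) (simp_all add: facts)
  moreover have "(g i, g j) \<in> R \<longleftrightarrow> j = i + 1 \<or> i = j + 1"
    if ij: "i \<in> {1..k + 2}" "j \<in> {1..k + 2}" for i j
    using pos[OF ij(1)] pos[OF ij(2)] by (elim disjE conjE bexE) (simp_all add: facts, auto)
  ultimately have "induced_path R (k + 2) g" unfolding induced_path_def inj_on_def by blast
  then show ?thesis by blast
qed

text \<open>
  If the path is not already induced in the old graph, it has a new edge, with ends \<open>f a\<close> and \<open>f b\<close> in
  the two neighbourhoods. A further vertex of the path in one of the neighbourhoods leads to a
  replacement, otherwise the new edge is subdivided.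
\<close>

lemma induced_path_add_biclique:
  assumes R: "sym R" "irrefl R" and xy: "(x, y) \<in> R"
    and path: "induced_path (add_biclique R x y) k f"
  shows "\<exists>g. induced_path R k g"
proof -
  have yx: "(y, x) \<in> R" using R(1) xy by (auto dest: symD)
  note path' = path[unfolded add_biclique_commute[of R x y]]
  have adj: "(f i, f j) \<in> add_biclique R x y \<longleftrightarrow> j = i + 1 \<or> i = j + 1"
    if "i \<in> {1..k}" "j \<in> {1..k}" for i j
    using path that by (auto simp: induced_path_def)
  show ?thesis
  proof (cases "induced_path R k f")
    case False
    then obtain i j where ij: "i \<in> {1..k}" "j \<in> {1..k}"
      and "\<not> ((f i, f j) \<in> R \<longleftrightarrow> j = i + 1 \<or> i = j + 1)"
      using path unfolding induced_path_def by blast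
    then have "(f i, f j) \<notin> R" "(f i, f j) \<in> add_biclique R x y"
      using adj[OF ij] by (auto simp: add_biclique_def)
    then obtain a b where ab: "a \<in> {1..k}" "b \<in> {1..k}" "f a \<in> R `` {x}" "f b \<in> R `` {y}" "(f a, f b) \<notin> R"
      using ij R(1) unfolding add_biclique_def by (blast dest: symD)
    show ?thesis
    proof (cases "\<exists>b'\<in>{1..k}. b' \<noteq> b \<and> f b' \<in> R `` {y}")
      case True
      then show ?thesis using induced_path_replace_centre[OF R xy path ab(1,3)] ab by blast
    next
      case Y: False
      show ?thesis
      proof (cases "\<exists>a'\<in>{1..k}. a' \<noteq> a \<and> f a' \<in> R `` {x}")
        case True
        then show ?thesis using induced_path_replace_centre[OF R yx path' ab(2,4)] ab by blast
      next
        case X: False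
        have "(f a, f b) \<in> add_biclique R x y" using ab by (auto simp: add_biclique_def)
        then consider "b = a + 1" | "a = b + 1" using adj ab by blast
        then have "\<exists>g. induced_path R (k + 2) g"
        proof cases
          case 1
          then show ?thesis
            using induced_path_subdivide[OF R xy path ab(1)] ab X Y by blast
        next
          case 2
          moreover have "(f b, f a) \<notin> R" using ab R(1) by (auto dest: symD)
          ultimately show ?thesis
            using induced_path_subdivide[OF R yx path' ab(2)] ab X Y by blast
        qed
        then show ?thesis using induced_path_shorter[of R "k + 2" _ k] by auto
      qed
    qed
  qed blast
qed


section \<open>The colon ideal and its graph\<close>

text \<open>
  The edges of \<open>es\<close> are added one at a time. This uses that each of them is still an edge of the graph
  obtained from the previous ones.
\<close>

lemma induced_path_even_connected:
  assumes "R \<subseteq> A \<times> B" and "A \<inter> B = {}" and "set es \<subseteq> R"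
    and "induced_path (even_connected R es \<union> (even_connected R es)\<inverse>) k f"
  shows "\<exists>g. induced_path (R \<union> R\<inverse>) k g"
  using assms(3,4)
proof (induction es arbitrary: f)
  case Nil
  then show ?case by (auto simp: even_connected_Nil)
next
  case (Cons e es)
  obtain x y where e: "e = (x, y)" by (cases e)
  let ?E = "even_connected R es"
  let ?H = "?E \<union> ?E\<inverse>"
  have E: "?E \<subseteq> A \<times> B" using assms(1) by (rule even_connected_subset)
  have xy: "(x, y) \<in> ?E" using Cons.prems(1) e even_connected_base[of R es] by auto
  then have "x \<in> A" "x \<notin> B" "y \<in> B" "y \<notin> A" using E assms(2) by auto
  then have "?H `` {x} = ?E `` {x}" "?H `` {y} = ?E\<inverse> `` {y}" using E by auto
  then have step: "even_connected R (e # es) \<union> (even_connected R (e # es))\<inverse> = add_biclique ?H x y"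
    unfolding e even_connected_Cons add_biclique_def by auto
  have "sym ?H" by (auto simp: sym_def)
  moreover have "irrefl ?H" using E assms(2) by (auto simp: irrefl_def)
  ultimately obtain g where "induced_path ?H k g"
    using induced_path_add_biclique[of ?H x y k f] Cons.prems(2) xy unfolding step by auto
  then show ?case using Cons.IH Cons.prems(1) by simp
qed

text \<open>
  The ideal on the left is the colon ideal of the power of an edge ideal. Both sides are monomial
  ideals, so it suffices that the same exponents occur in them.
\<close>

lemma colon_eq_even_connected_ideal:
  fixes R :: "('v :: finite \<times> 'v) set"
  assumes R: "R \<subseteq> A \<times> B" "A \<inter> B = {}" and es: "set es \<subseteq> R"
  shows "ideal_colon (monomial_ideal (edge_products R (Suc (length es)))) (prod_list (map edge_monomial es))
    = (monomial_ideal (edge_exponent ` even_connected R es) :: ('v, 'k :: field) polynomial set)"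
proof -
  let ?m = "sum_list (map edge_exponent es)"
  have iff: "(\<exists>s\<in>edge_products R (Suc (length es)). \<exists>r. t + ?m = s + r)
      \<longleftrightarrow> (\<exists>e\<in>even_connected R es. \<exists>r. t = edge_exponent e + r)" for t
  proof
    assume "\<exists>s\<in>edge_products R (Suc (length es)). \<exists>r. t + ?m = s + r"
    then obtain fs r where "set fs \<subseteq> R" "length fs = Suc (length es)"
      "t + ?m = sum_list (map edge_exponent fs) + r"
      unfolding edge_products_def by blast
    then show "\<exists>e\<in>even_connected R es. \<exists>r. t = edge_exponent e + r"
      by (rule even_connected_if_edge_product_divides[OF R es])
  next
    assume "\<exists>e\<in>even_connected R es. \<exists>r. t = edge_exponent e + r"
    then obtain u v r where uv: "(u, v) \<in> even_connected R es" and "t = edge_exponent (u, v) + r"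
      by auto
    then have "t + ?m = (edge_exponent (u, v) + ?m) + r" by (simp add: ac_simps)
    then show "\<exists>s\<in>edge_products R (Suc (length es)). \<exists>r. t + ?m = s + r"
      using even_connected_in_edge_products[OF es uv] by blast
  qed
  show ?thesis
    unfolding prod_list_edge_monomials ideal_colon_monomial_ideal iff
    using monomial_ideal_multiples[of "edge_exponent ` even_connected R es"]
    by (simp only: bex_simps)
qed

lemma image_edge_exponent_symcl: "edge_exponent ` (R \<union> R\<inverse>) = edge_exponent ` R"
proof -
  have "edge_exponent ` R\<inverse> \<subseteq> edge_exponent ` R"
    using edge_exponent_swap by (force simp: image_iff)
  then show ?thesis by (simp add: image_Un Un_absorb2)
qed

text \<open>
  Reversing some of the given edges changes neither their product nor the colon ideal; so they may be
  assumed to be directed like \<open>R\<close>.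
\<close>

theorem theorem4p3:
  fixes G :: "'v :: finite pair_pre_digraph"
    and k s :: nat
    and es :: "('v \<times> 'v) list"
    and J :: "('v, 'k :: field) polynomial set"
  assumes "k \<ge> 4"
    and "pair_graph G" and "pverts G = UNIV"
    and "bipartite G" and "induced_free (path_graph k) G"
    and "s \<ge> 1" and "length es = s" and "set es \<subseteq> parcs G"
    and "J = ideal_colon (ideal_power (edge_ideal G) (s + 1)) (prod_list (map edge_monomial es))"
  shows "(\<exists>!G'. is_graph_of_ideal J G') \<and>
    (\<forall>G'. is_graph_of_ideal J G' \<longrightarrow> bipartite G' \<and> induced_free (path_graph k) G')"
proof -
  interpret pair_graph G by fact
  obtain A B where AB: "A \<union> B = UNIV" "A \<inter> B = {}" "parcs G \<subseteq> A \<times> B \<union> B \<times> A"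
    using assms(3,4) unfolding bipartite_def by metis
  define R where "R = parcs G \<inter> A \<times> B"
  have R: "R \<subseteq> A \<times> B" by (simp add: R_def)
  have G: "parcs G = R \<union> R\<inverse>"
    using AB(3) arcs_symmetric by (auto simp: R_def)
  obtain es' where es': "length es' = length es" "set es' \<subseteq> R"
    "sum_list (map edge_exponent es') = sum_list (map edge_exponent es)"
    using orient_edges[of es R] assms(8) G by auto
  define E where "E = even_connected R es'"
  have E: "E \<subseteq> A \<times> B" unfolding E_def using R by (rule even_connected_subset)
  define H where "H = \<lparr> pverts = (UNIV :: 'v set), parcs = E \<union> E\<inverse> \<rparr>"
  have "prod_list (map edge_monomial es) = (prod_list (map edge_monomial es') :: ('v, 'k) polynomial)"
    by (simp add: prod_list_edge_monomials es'(3))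
  then have "J = monomial_ideal (edge_exponent ` E)"
    using colon_eq_even_connected_ideal[OF R AB(2) es'(2)] es'(1)
    by (simp add: assms(7,9) E_def ideal_power_edge_ideal G edge_products_symcl del: ideal_power.simps)
  then have J: "edge_ideal H = J"
    by (simp add: edge_ideal_eq_monomial_ideal H_def image_edge_exponent_symcl del: image_Un)
  have pgH: "pair_graph H"
    using E AB(2) by unfold_locales (auto simp: H_def symmetric_def sym_def)
  have H: "is_graph_of_ideal J H"
    using pgH J by (simp add: is_graph_of_ideal_def H_def)
  have unique: "H' = H" if "is_graph_of_ideal J H'" for H'
  proof -
    have "pair_graph H'" "edge_ideal H' = J" "pverts H' = UNIV"
      using that J by (simp_all add: is_graph_of_ideal_def)
    then have "parcs H' = parcs H" "pverts H' = pverts H"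
      using edge_ideal_inj[of H' H, where ?'k = 'k] edge_ideal_inj[of H H', where ?'k = 'k] pgH J
      by (auto simp: H_def)
    then show ?thesis by simp
  qed
  have "bipartite H"
    unfolding bipartite_def using AB E by (intro exI[of _ A] exI[of _ B]) (auto simp: H_def)
  moreover have "induced_free (path_graph k) H"
    using assms(3,5) induced_path_even_connected[OF R AB(2) es'(2)]
    unfolding induced_free_path_graph_iff[OF pgH] induced_free_path_graph_iff[OF assms(2)]
    by (simp add: H_def E_def G) blast
  ultimately show ?thesis using H unique by metis
qed

end
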